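(* Let $X,Y$ be finite dimensional normed spaces, $\Omega\subseteq X$ a closed set, $F:X\rightrightarrows Y$ a closed-graph set-valued mapping, $K:X\rightrightarrows Y$ a closed-graph variable domination structure, and $(\overline{x},\overline{y})\in X\times Y$ such that $\overline{x}\in\Omega$, $(\overline{x},\overline{y})\in\operatorname{Gr}F$, $(\overline{x},0)\in\operatorname{Gr}K$. Suppose that: (a) (Aubin conditions) $F$ and $K$ have the Aubin property around $(\overline{x},\overline{y})$ and $(\overline{x},0)$, respectively. (b) (Constants conditions) $\varepsilon\in(0,\infty]$ and $\delta\in(0,\infty)$ are such that one of the following holds: (b.i) $\varepsilon>\frac1{16}$ and $\delta\in(0,\frac14)$; (b.ii) $\delta<\frac14$, $\delta<\varepsilon$ and $\sqrt{\delta}-\delta<\varepsilon$. (c) (Interiority condition) For this $\varepsilon$, denote $P:=\bigcap_{x\in B(\overline{x},\varepsilon)}K(x)$ and suppose that $k\in S_Y\cap\operatorname{int}P$. (d) (Approximate solution condition) $(\overline{x},\overline{y})$ is an $(\varepsilon,\delta,k)$-nondominated solution with respect to $K$ for $F$ on $\Omega$. Let $\varphi:[0,\infty)\to[0,\frac14)$ be the increasing continuous bijection $$\varphi(x):=\frac14\left(\sqrt{1+x}-1\right)\left(\frac{1}{\sqrt{x+1}}-\frac{1}{x+1}\right).$$ Then there exist $y^{\ast}\in P^{+}$ with $\langle y^{\ast},k\rangle=1$, $(x_1,y_1)\in\operatorname{Gr}F\cap[\overline{B}(\overline{x},\varphi^{-1}(\delta))\times\overline{B}(\overline{y},\varphi^{-1}(\delta))]$,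 $(x_2,y_2)\in\operatorname{Gr}K\cap[\overline{B}(\overline{x},\varphi^{-1}(\delta))\times\overline{B}(0,\varphi^{-1}(\delta))]$, $x_3\in\Omega\cap\overline{B}(\overline{x},\varphi^{-1}(\delta))$, and $z^{\ast}\in2\varphi^{-1}(\delta)\overline{B}_{Y^{\ast}}$ such that $$0\in D^{\ast}F(x_1,y_1)(y^{\ast}-z^{\ast})+D^{\ast}K(x_2,y_2)(y^{\ast})+N(\Omega,x_3)+\varphi^{-1}(\delta)\overline{B}_{X^{\ast}}.$$
   Context: $B(x,r)$ and $\overline{B}(x,r)$ are the open and closed balls, with $B(\overline{x},+\infty):=X$; $S_Y$ is the unit sphere of $Y$, $\overline{B}_{X^{\ast}},\overline{B}_{Y^{\ast}},\overline{B}_Y$ are closed unit balls; $\operatorname{Gr}F=\{(x,y)\mid y\in F(x)\}$; $P^{+}:=\{y^{\ast}\in Y^{\ast}\mid\langle y^{\ast},y\rangle\ge0\ \forall y\in P\}$. A variable domination structure is a set-valued mapping whose values are closed, convex, proper and pointed cones (a cone $C$ is pointed if $C\cap(-C)=\{0\}$). $(\overline{x},\overline{y})\in\operatorname{Gr}F\cap(\Omega\times Y)$ is an $(\varepsilon,\delta,k)$-nondominated solution with respect to $K$ for $F$ on $\Omega$ if for every $x\in B(\overline{x},\varepsilon)\cap\Omega$, $(F(x)-\overline{y}+\delta k)\cap(-K(x))\subseteq\{0\}$. A set-valued mapping $F$ has the Aubin property around $(\overline{x},\overline{y})\in\operatorname{Gr}F$ if there are $\ell>0$ and neighborhoods $U$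 of $\overline{x}$ and $V$ of $\overline{y}$ such that $F(x)\cap V\subseteq F(u)+\ell\|x-u\|\overline{B}_Y$ for all $x,u\in U$. Fréchet normal cone: for $x\in S$, $\widehat{N}(S,x):=\{x^{\ast}\mid\limsup_{u\to x,\,u\in S}\frac{\langle x^{\ast},u-x\rangle}{\|u-x\|}\le0\}$. Limiting (Mordukhovich) normal cone, for $S$ closed around $x\in S$: $N(S,x):=\{x^{\ast}\mid\exists x_n\to x,\ x_n\in S,\ x_n^{\ast}\to x^{\ast}\text{ (weak}^{\ast}),\ x_n^{\ast}\in\widehat{N}(S,x_n)\ \forall n\}$. Mordukhovich coderivative at $(x,y)\in\operatorname{Gr}F$: $D^{\ast}F(x,y)(y^{\ast}):=\{x^{\ast}\mid(x^{\ast},-y^{\ast})\in N(\operatorname{Gr}F,(x,y))\}$. *)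

theory Defs
  imports "HOL-Analysis.Analysis"
begin

text \<open>
  Set-valued mappings are functions into sets. On sets, \<open>+\<close> is the Minkowski sum, whereas
  \<open>-\<close> is set difference and complement; reflections and translations are therefore
  written as images. The topological dual of a normed space \<open>'a\<close> is \<open>'a \<Rightarrow>\<^sub>L real\<close>
  with its operator norm.
\<close>

definition Gr :: "('a \<Rightarrow> 'b set) \<Rightarrow> ('a \<times> 'b) set" where
  "Gr F = {(x, y). y \<in> F x}"

definition positive_dual :: "'b::real_normed_vector set \<Rightarrow> ('b \<Rightarrow>\<^sub>L real) set" where
  "positive_dual P = {ys. \<forall>y\<in>P. 0 \<le> blinfun_apply ys y}"

definition pointed :: "'b::real_vector set \<Rightarrow> bool" where
  "pointed C \<longleftrightarrow> C \<inter> uminus ` C = {0}"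

text \<open>As usual in vector optimization, a cone is proper if it is neither \<open>{0}\<close> nor the
  whole space.\<close>

definition proper_cone :: "'b::real_vector set \<Rightarrow> bool" where
  "proper_cone C \<longleftrightarrow> cone C \<and> C \<noteq> {0} \<and> C \<noteq> UNIV"

definition variable_domination_structure ::
    "('a \<Rightarrow> 'b::real_normed_vector set) \<Rightarrow> bool" where
  "variable_domination_structure K \<longleftrightarrow>
     (\<forall>x. closed (K x) \<and> convex (K x) \<and> proper_cone (K x) \<and> pointed (K x))"

definition nondominated_solution ::
    "ereal \<Rightarrow> real \<Rightarrow> 'b \<Rightarrow> ('a::real_normed_vector \<Rightarrow> 'b::real_normed_vector set) \<Rightarrow>
     ('a \<Rightarrow> 'b set) \<Rightarrow> 'a set \<Rightarrow> 'a \<Rightarrow> 'b \<Rightarrow> bool" where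
  "nondominated_solution \<epsilon> \<delta> k K F \<Omega> xb yb \<longleftrightarrow>
     (xb, yb) \<in> Gr F \<inter> (\<Omega> \<times> UNIV) \<and>
     (\<forall>x \<in> eball xb \<epsilon> \<inter> \<Omega>.
        (\<lambda>y. y - yb + \<delta> *\<^sub>R k) ` F x \<inter> uminus ` K x \<subseteq> {0})"

definition aubin_property ::
    "('a::real_normed_vector \<Rightarrow> 'b::real_normed_vector set) \<Rightarrow> 'a \<Rightarrow> 'b \<Rightarrow> bool" where
  "aubin_property F xb yb \<longleftrightarrow>
     (\<exists>l>0. \<exists>U V. open U \<and> xb \<in> U \<and> open V \<and> yb \<in> V \<and>
        (\<forall>x\<in>U. \<forall>u\<in>U. F x \<inter> V \<subseteq> F u + (\<lambda>b. (l * norm (x - u)) *\<^sub>R b) ` cball 0 1))"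

text \<open>At an isolated point of \<open>S\<close> the filter is trivial and the upper limit is \<open>-\<infinity>\<close>,
  so that every functional is normal there.\<close>

definition frechet_normal_cone ::
    "'a::real_normed_vector set \<Rightarrow> 'a \<Rightarrow> ('a \<Rightarrow>\<^sub>L real) set" where
  "frechet_normal_cone S x =
     {xs. Limsup (at x within S)
            (\<lambda>u. ereal (blinfun_apply xs (u - x) / norm (u - x))) \<le> 0}"

text \<open>Weak* convergence of functionals is pointwise convergence.\<close>

definition limiting_normal_cone ::
    "'a::real_normed_vector set \<Rightarrow> 'a \<Rightarrow> ('a \<Rightarrow>\<^sub>L real) set" where
  "limiting_normal_cone S x =
     {xs. \<exists>(p :: nat \<Rightarrow> 'a) (ps :: nat \<Rightarrow> 'a \<Rightarrow>\<^sub>L real).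
        p \<longlonglongrightarrow> x \<and> (\<forall>n. p n \<in> S) \<and>
        (\<forall>v. (\<lambda>n. blinfun_apply (ps n) v) \<longlonglongrightarrow> blinfun_apply xs v) \<and>
        (\<forall>n. ps n \<in> frechet_normal_cone S (p n))}"

text \<open>The pair \<open>(xs, ys)\<close> as the functional \<open>(u, v) \<mapsto> xs u + ys v\<close> on the product space.
  The product carries the norm \<open>sqrt ((norm u)\<^sup>2 + (norm v)\<^sup>2)\<close>; the normal cones depend on it
  only up to equivalence of norms.\<close>

definition dual_pair ::
    "('a::real_normed_vector \<Rightarrow>\<^sub>L real) \<Rightarrow> ('b::real_normed_vector \<Rightarrow>\<^sub>L real) \<Rightarrow>
     ('a \<times> 'b) \<Rightarrow>\<^sub>L real" where
  "dual_pair xs ys = (xs o\<^sub>L fst_blinfun) + (ys o\<^sub>L snd_blinfun)"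

lemma dual_pair_apply: "blinfun_apply (dual_pair xs ys) (u, v) = xs u + ys v"
  by (simp add: dual_pair_def blinfun.add_left)

definition coderivative ::
    "('a::real_normed_vector \<Rightarrow> 'b::real_normed_vector set) \<Rightarrow> 'a \<Rightarrow> 'b \<Rightarrow>
     ('b \<Rightarrow>\<^sub>L real) \<Rightarrow> ('a \<Rightarrow>\<^sub>L real) set" where
  "coderivative F x y ys = {xs. dual_pair xs (- ys) \<in> limiting_normal_cone (Gr F) (x, y)}"

definition phi :: "real \<Rightarrow> real" where
  "phi x = 1/4 * (sqrt (1 + x) - 1) * (1 / sqrt (x + 1) - 1 / (x + 1))"

definition phi_inv :: "real \<Rightarrow> real" where
  "phi_inv = the_inv_into {0..} phi"

text \<open>The facts about \<open>phi\<close> that make \<open>phi_inv\<close> a genuine inverse on \<open>{0..<1/4}\<close>.\<close>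

lemma phi_eq:
  assumes "0 \<le> x"
  shows "phi x = 1/4 * (1 - 1 / sqrt (1 + x))\<^sup>2"
proof -
  define t where "t = sqrt (1 + x)"
  have t: "t > 0" and x: "x + 1 = t\<^sup>2"
    using assms by (auto simp: t_def)
  have "phi x = 1/4 * (t - 1) * (1 / t - 1 / t\<^sup>2)"
    unfolding phi_def using x by (simp add: t_def add.commute)
  also have "\<dots> = 1/4 * (1 - 1 / t)\<^sup>2"
    using t by (simp add: field_simps power2_eq_square)
  finally show ?thesis by (simp add: t_def)
qed

lemma phi_strict_mono_on: "strict_mono_on {0..} phi"
proof (rule strict_mono_onI)
  fix x y :: real
  assume "x \<in> {0..}" "y \<in> {0..}" "x < y"
  then have xy: "0 \<le> x" "x < y" by auto
  have "1 / sqrt (1 + y) < 1 / sqrt (1 + x)"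
    using xy by (intro divide_strict_left_mono) auto
  moreover have "1 / sqrt (1 + x) \<le> 1" using xy by simp
  ultimately have "(1 - 1 / sqrt (1 + x))\<^sup>2 < (1 - 1 / sqrt (1 + y))\<^sup>2"
    by (intro power_strict_mono) auto
  then show "phi x < phi y" using xy by (simp add: phi_eq)
qed

lemma phi_continuous_on: "continuous_on {0..} phi"
  unfolding phi_def by (intro continuous_intros) auto

lemma phi_bij_betw: "bij_betw phi {0..} {0..<1/4}"
proof (rule bij_betw_imageI)
  show "inj_on phi {0..}"
    by (rule strict_mono_on_imp_inj_on[OF phi_strict_mono_on])
  show "phi ` {0..} = {0..<1/4}"
  proof (intro equalityI subsetI)
    fix d assume "d \<in> phi ` {0..}"
    then obtain x where x: "0 \<le> x" "d = phi x" by auto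
    have r: "0 < 1 / sqrt (1 + x)" "1 / sqrt (1 + x) \<le> 1" using x by auto
    then have "(1 - 1 / sqrt (1 + x))\<^sup>2 < 1\<^sup>2"
      by (intro power_strict_mono) auto
    moreover have "0 \<le> (1 - 1 / sqrt (1 + x))\<^sup>2" by simp
    ultimately show "d \<in> {0..<1/4}"
      unfolding x(2) phi_eq[OF x(1)] atLeastLessThan_iff by simp
  next
    fix d :: real assume "d \<in> {0..<1/4}"
    then have d: "0 \<le> d" "d < 1/4" by auto
    have s: "sqrt d < 1/2"
      using real_sqrt_less_mono[OF d(2)] by (simp add: real_sqrt_divide)
    define r where "r = 1 - 2 * sqrt d"
    have r: "0 < r" "r \<le> 1" using s d by (auto simp: r_def)
    have x: "1 / r\<^sup>2 - 1 \<ge> 0" using r by (simp add: power_le_one)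
    have "sqrt (1 + (1 / r\<^sup>2 - 1)) = 1 / r"
      using r by (simp add: real_sqrt_divide)
    then have "phi (1 / r\<^sup>2 - 1) = 1/4 * (1 - r)\<^sup>2"
      using phi_eq[OF x] by simp
    also have "\<dots> = d" using d by (simp add: r_def power_mult_distrib)
    finally show "d \<in> phi ` {0..}" using x by (metis atLeast_iff imageI)
  qed
qed

end

theory Submission
  imports Defs
begin

text \<open>
  Consider the least \<open>\<tau>\<close> such that \<open>yb + \<tau> k \<in> F x + K x\<close> for some \<open>x \<in> \<Omega>\<close> near \<open>xb\<close>. Since \<open>k\<close>
  lies in every \<open>K x\<close>, nondominatedness forces \<open>\<tau> \<ge> - \<delta>\<close>, while \<open>\<tau> = 0\<close> is attained at
  \<open>xb\<close>. Adding the terms \<open>\<gamma> \<parallel>x - xb\<parallel> + \<eta> \<parallel>y - yb\<parallel> + \<eta> \<parallel>w\<parallel>\<close>, where \<open>yb + \<tau> k = y + w\<close>, keeps minimizers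
  within the distances \<open>\<delta> / \<gamma>\<close>, \<open>\<delta> / \<eta>\<close> of the base point. The three constraints
  \<open>(x, y) \<in> Gr F\<close>, \<open>(x, w) \<in> Gr K\<close>, \<open>x \<in> \<Omega>\<close> are decoupled: each gets its own point, tied to
  \<open>(x, y, w)\<close> by a smooth quadratic penalty with a large weight. At a minimizer the derivatives of the
  penalty are Frechet normals to the three sets, and stationarity in \<open>x\<close>, \<open>y\<close>, \<open>\<tau>\<close> gives the
  estimates for their sums; as the three base points may differ, no calculus rule for the normal
  cone of an intersection enters. Dividing by the value of the multiplier at \<open>k\<close>, which is at least \<open>1 - \<eta>\<close>, normalizes it;
  it is positive on \<open>P\<close> because the values of \<open>K\<close> are convex cones.
\<close>

section \<open>Compactness and quadratic forms in finite-dimensional normed spaces\<close>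

text \<open>Induction on \<open>B\<close>: the component along a new vector \<open>b\<close> is a
  bounded real sequence, because \<open>b\<close> has positive distance from the span of the old
  vectors. Subsequences are extracted first for this component, then for the remainder.\<close>

lemma bounded_subseq_convergent_span_finite:
  fixes B :: "'a::real_normed_vector set"
    and f :: "nat \<Rightarrow> 'a"
  assumes "finite B" "bounded (range f)" "range f \<subseteq> span B"
  shows "\<exists>l\<in>span B. \<exists>r::nat \<Rightarrow> nat. strict_mono r \<and> (f \<circ> r) \<longlonglongrightarrow> l"
  using assms
proof (induction B arbitrary: f rule: finite_induct)
  case empty
  then have "f = (\<lambda>_. 0)" by auto
  then show ?case by (intro bexI[of _ 0] exI[of _ id]) (auto simp: strict_mono_def)
next
  case (insert b B)
  \<comment> \<open>Closedness of the smaller span follows from the induction hypothesis itself: a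
    convergent sequence is bounded, so it has a subsequential limit in \<open>span B\<close>, which
    must be its limit.\<close>
  have seqlim: "l \<in> span B" if g: "\<And>n. g n \<in> span B" "g \<longlonglongrightarrow> l" for g :: "nat \<Rightarrow> 'a" and l
  proof -
    have "bounded (range g)" using g(2) convergent_imp_bounded by blast
    then obtain l' r where "l' \<in> span B" "strict_mono (r::nat\<Rightarrow>nat)" "(g \<circ> r) \<longlonglongrightarrow> l'"
      using insert.IH[of g] g(1) by blast
    moreover have "(g \<circ> r) \<longlonglongrightarrow> l" using g(2) calculation(2) by (rule LIMSEQ_subseq_LIMSEQ)
    ultimately show ?thesis using LIMSEQ_unique by blast
  qed
  then have cl: "closed (span B)" by (simp add: closed_sequential_limits) blast
  show ?case
  proof (cases "b \<in> span B")
    case True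
    then have "span (insert b B) = span B" by (rule span_redundant)
    then show ?thesis using insert by simp
  next
    case False
    define d where "d = infdist b (span B)"
    have d: "d > 0"
      using False cl span_zero[of B] in_closed_iff_infdist_zero[OF cl, of b] infdist_nonneg[of b "span B"]
      unfolding d_def by fastforce
    have "\<exists>a. f n - a *\<^sub>R b \<in> span B" for n
      using insert.prems(2) by (auto simp: span_insert)
    then obtain a where a: "\<And>n. f n - a n *\<^sub>R b \<in> span B" by metis
    obtain M where M: "\<And>n. norm (f n) \<le> M"
      using insert.prems(1) by (auto simp: bounded_iff)
    have "\<bar>a n\<bar> * d \<le> M" for n
    proof (cases "a n = 0")
      case True
      then show ?thesis using order_trans[OF norm_ge_zero M[of n]] by simp
    next
      case False
      \<comment> \<open>A point of \<open>span B\<close> at distance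
        \<open>norm (f n) / \<bar>a n\<bar>\<close> from \<open>b\<close>; this distance is at least
        \<open>d\<close>.\<close>
      define v where "v = (- 1 / a n) *\<^sub>R (f n - a n *\<^sub>R b)"
      have "v \<in> span B" unfolding v_def using a by (rule span_scale)
      then have "d \<le> dist b v" unfolding d_def by (rule infdist_le)
      also have "b - v = (1 / a n) *\<^sub>R f n" using False by (simp add: v_def algebra_simps)
      then have "dist b v = norm (f n) / \<bar>a n\<bar>" by (simp add: dist_norm)
      finally show ?thesis using False M[of n] by (simp add: field_simps)
    qed
    then have "bounded (range a)"
      using d by (auto simp: bounded_iff field_simps intro!: exI[of _ "M/d"])
    then obtain s l where s: "strict_mono (s::nat\<Rightarrow>nat)" "(a \<circ> s) \<longlonglongrightarrow> l"
      using bounded_imp_convergent_subsequence[of a] by blast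
    define g where "g n = f (s n) - a (s n) *\<^sub>R b" for n
    have gB: "range g \<subseteq> span B" using a by (auto simp: g_def)
    have "bounded (range (\<lambda>n. f (s n)))" using M by (auto simp: bounded_iff)
    moreover have "bounded (range (\<lambda>n. a (s n) *\<^sub>R b))"
      using convergent_imp_bounded[OF tendsto_scaleR[OF s(2) tendsto_const[of b]]] by (simp add: o_def)
    ultimately have "bounded (range g)"
      unfolding g_def by (rule bounded_minus_comp)
    then obtain l' r where r: "l' \<in> span B" "strict_mono (r::nat\<Rightarrow>nat)" "(g \<circ> r) \<longlonglongrightarrow> l'"
      using insert.IH[of g] gB by blast
    have "(\<lambda>n. (a \<circ> s \<circ> r) n *\<^sub>R b + (g \<circ> r) n) \<longlonglongrightarrow> l *\<^sub>R b + l'"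
      by (intro tendsto_intros r(3) LIMSEQ_subseq_LIMSEQ[OF s(2) r(2)])
    then have "(f \<circ> (s \<circ> r)) \<longlonglongrightarrow> l *\<^sub>R b + l'" by (simp add: g_def o_def)
    moreover have "l *\<^sub>R b + l' \<in> span (insert b B)"
      using r(1) by (auto simp: span_insert intro!: exI[of _ l])
    ultimately show ?thesis using strict_mono_o[OF s(1) r(2)] by blast
  qed
qed

lemma closed_span_finite:
  fixes B :: "'a::real_normed_vector set"
  assumes "finite B"
  shows "closed (span B)"
  unfolding closed_sequential_limits
proof (intro allI impI)
  fix g :: "nat \<Rightarrow> 'a" and l assume g: "(\<forall>n. g n \<in> span B) \<and> g \<longlonglongrightarrow> l"
  then obtain l' r where "l' \<in> span B" "strict_mono (r::nat\<Rightarrow>nat)" "(g \<circ> r) \<longlonglongrightarrow> l'"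
    using bounded_subseq_convergent_span_finite[OF assms, of g] convergent_imp_bounded[of g l] by blast
  then show "l \<in> span B" using g LIMSEQ_subseq_LIMSEQ LIMSEQ_unique by blast
qed

lemma compact_cball_finite_dimension:
  fixes a :: "'a::real_normed_vector"
  assumes "\<exists>B::'a set. finite B \<and> span B = UNIV"
  shows "compact (cball a e)"
  unfolding compact_eq_seq_compact_metric seq_compact_def
proof (intro allI impI)
  obtain B :: "'a set" where B: "finite B" "span B = UNIV" using assms by blast
  fix f :: "nat \<Rightarrow> 'a" assume f: "\<forall>n. f n \<in> cball a e"
  then have "bounded (range f)" by (intro bounded_subset[OF bounded_cball[of a e]]) auto
  then obtain l r where "strict_mono (r::nat\<Rightarrow>nat)" "(f \<circ> r) \<longlonglongrightarrow> l"
    using bounded_subseq_convergent_span_finite[OF B(1), of f] B(2) by auto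
  moreover from this(2) have "l \<in> cball a e"
    by (rule closed_sequentially[OF closed_cball, rotated]) (use f in auto)
  ultimately show "\<exists>l\<in>cball a e. \<exists>r. strict_mono r \<and> (f \<circ> r) \<longlonglongrightarrow> l" by blast
qed

text \<open>The coordinate at \<open>b\<close> is bounded by the reciprocal of the distance from
  \<open>b\<close> to the closed span of the other basis vectors.\<close>

lemma bounded_linear_representation:
  fixes B :: "'a::real_normed_vector set"
  assumes "finite B" "independent B" "span B = UNIV"
  shows "bounded_linear (\<lambda>v. representation B v b)"
proof (cases "b \<in> B")
  case False
  then have "(\<lambda>v. representation B v b) = (\<lambda>v. 0)" using representation_ne_zero by blast
  then show ?thesis by simp
next
  case True
  define V where "V = span (B - {b})"
  define d where "d = infdist b V"
  have cl: "closed V" unfolding V_def using assms(1) by (intro closed_span_finite) auto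
  have "b \<notin> V" using True assms(2) unfolding V_def by (simp add: dependent_def)
  then have d: "d > 0"
    using cl in_closed_iff_infdist_zero[OF cl, of b] infdist_nonneg[of b V] span_zero[of "B - {b}"]
    unfolding d_def V_def by fastforce
  have "norm (representation B v b) \<le> norm v * (1/d)" for v
  proof (cases "representation B v b = 0")
    case True
    then show ?thesis using d by simp
  next
    case False
    define a where "a = representation B v b"
    define w where "w = (\<Sum>c\<in>B - {b}. representation B v c *\<^sub>R c)"
    have "v = (\<Sum>c\<in>B. representation B v c *\<^sub>R c)"
      using assms by (simp add: sum_representation_eq)
    then have v: "v = a *\<^sub>R b + w"
      unfolding w_def a_def using True assms(1) by (simp add: sum.remove)
    have "w \<in> V" unfolding w_def V_def by (intro span_sum span_scale span_base)
    then have "(- 1 / a) *\<^sub>R w \<in> V" unfolding V_def by (rule span_scale)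
    then have "d \<le> dist b ((- 1 / a) *\<^sub>R w)" unfolding d_def by (rule infdist_le)
    also have "b - (- 1 / a) *\<^sub>R w = (1 / a) *\<^sub>R v"
      using False by (subst v) (simp add: a_def[symmetric] scaleR_add_right)
    then have "dist b ((- 1 / a) *\<^sub>R w) = norm v / \<bar>a\<bar>" by (simp add: dist_norm)
    finally show ?thesis using False d by (simp add: a_def[symmetric] field_simps)
  qed
  then show ?thesis
    by (intro bounded_linear_intro[where K = "1/d"])
       (use assms in \<open>auto simp: representation_add representation_scale\<close>)
qed

text \<open>The inner product that makes a basis orthonormal. The given norm need not be
  differentiable away from 0; the square of this form is smooth and can serve as a penalty with
  explicit derivatives.\<close>

lemma positive_definite_form_finite_dimension:
  assumes "\<exists>B::'a set. finite B \<and> span B = UNIV"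
  obtains \<beta> :: "'a::real_normed_vector \<Rightarrow> 'a \<Rightarrow> real"
  where "bounded_bilinear \<beta>" "\<And>u v. \<beta> u v = \<beta> v u" "\<And>v. v \<noteq> 0 \<Longrightarrow> 0 < \<beta> v v"
proof -
  obtain B0 :: "'a set" where B0: "finite B0" "span B0 = UNIV" using assms by blast
  obtain B where B: "B \<subseteq> B0" "independent B" "B0 \<subseteq> span B"
    using maximal_independent_subset[of B0] by blast
  have fin: "finite B" using B(1) B0(1) finite_subset by blast
  have span: "span B = UNIV" using B(3) B0(2) span_minimal[OF B(3) subspace_span] by blast
  define f where "f b v = representation B v b" for b v
  have bl: "bounded_linear (f b)" for b
    using bounded_linear_representation[OF fin B(2) span, of b] by (simp add: f_def[abs_def])
  define \<beta> where "\<beta> u v = (\<Sum>b\<in>B. f b u * f b v)" for u v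
  have "bounded_bilinear \<beta>"
  proof
    fix a a' c c' :: 'a and r :: real
    show "\<beta> (a + a') c = \<beta> a c + \<beta> a' c" "\<beta> a (c + c') = \<beta> a c + \<beta> a c'"
      by (simp_all add: \<beta>_def bounded_linear.linear[OF bl, THEN linear_add] algebra_simps sum.distrib)
    show "\<beta> (r *\<^sub>R a) c = r *\<^sub>R \<beta> a c" "\<beta> a (r *\<^sub>R c) = r *\<^sub>R \<beta> a c"
      by (simp_all add: \<beta>_def bounded_linear.linear[OF bl, THEN linear_scale] sum_distrib_left algebra_simps)
  next
    show "\<exists>M. \<forall>a c. norm (\<beta> a c) \<le> norm a * norm c * M"
    proof (intro exI allI)
      fix a c
      have "norm (\<beta> a c) \<le> (\<Sum>b\<in>B. \<bar>f b a\<bar> * \<bar>f b c\<bar>)"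
        unfolding \<beta>_def by (rule order_trans[OF norm_sum]) (simp add: abs_mult)
      also have "\<dots> \<le> (\<Sum>b\<in>B. (onorm (f b) * norm a) * (onorm (f b) * norm c))"
        using onorm[OF bl] by (intro sum_mono mult_mono) (auto simp: onorm_pos_le[OF bl])
      also have "\<dots> = norm a * norm c * (\<Sum>b\<in>B. onorm (f b) * onorm (f b))"
        by (simp add: sum_distrib_left algebra_simps)
      finally show "norm (\<beta> a c) \<le> norm a * norm c * (\<Sum>b\<in>B. onorm (f b) * onorm (f b))" .
    qed
  qed
  moreover have "0 < \<beta> v v" if "v \<noteq> 0" for v
  proof -
    have "v = (\<Sum>b\<in>B. f b v *\<^sub>R b)"
      unfolding f_def using fin B(2) span by (simp add: sum_representation_eq)
    moreover have "(\<Sum>b\<in>B. f b v *\<^sub>R b) = 0" if "\<forall>b\<in>B. f b v = 0"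
      using that by (intro sum.neutral) auto
    ultimately obtain b where "b \<in> B" "f b v \<noteq> 0"
      using \<open>v \<noteq> 0\<close> by fastforce
    then show ?thesis unfolding \<beta>_def by (intro sum_pos2[OF fin, of b]) (auto simp: zero_less_mult_iff)
  qed
  ultimately show ?thesis using that[of \<beta>] by (simp add: \<beta>_def mult.commute)
qed

section \<open>Frechet normals from quadratic estimates\<close>

text \<open>After division by \<open>norm (u - x)\<close> a quadratic upper bound tends to 0. This
  is the form in which minimality of a quadratic penalty yields normals.\<close>

lemma frechet_normal_coneI:
  assumes "0 < e" "\<And>u. u \<in> S \<Longrightarrow> dist u x < e \<Longrightarrow> blinfun_apply xs (u - x) \<le> C * (norm (u - x))\<^sup>2"
  shows "xs \<in> frechet_normal_cone S x"
  unfolding frechet_normal_cone_def mem_Collect_eq Limsup_le_iff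
proof (intro allI impI)
  fix y :: ereal assume "y > 0"
  then obtain s where s: "0 < s" "ereal s < y" using ereal_dense2[of 0 y] by auto
  have C: "s / (\<bar>C\<bar> + 1) > 0" using s by simp
  \<comment> \<open>The sign of \<open>C\<close> is arbitrary and \<open>C\<close> may be 0;
    \<open>\<bar>C\<bar> + 1\<close> is a positive majorant.\<close>
  have "\<forall>\<^sub>F u in at x within S. u \<in> S \<and> u \<noteq> x \<and> dist u x < e \<and> dist u x < s / (\<bar>C\<bar> + 1)"
    unfolding eventually_at
    by (rule exI[of _ "min e (s / (\<bar>C\<bar> + 1))"]) (use assms(1) C in auto)
  then show "\<forall>\<^sub>F u in at x within S. ereal (blinfun_apply xs (u - x) / norm (u - x)) < y"
  proof eventually_elim
    case (elim u)
    have n: "norm (u - x) > 0" using elim by simp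
    have "blinfun_apply xs (u - x) \<le> C * (norm (u - x))\<^sup>2" using assms(2) elim by blast
    then have "blinfun_apply xs (u - x) / norm (u - x) \<le> C * norm (u - x)"
      using n by (simp add: field_simps power2_eq_square)
    also have "\<dots> \<le> (\<bar>C\<bar> + 1) * norm (u - x)" using n by (intro mult_right_mono) auto
    also have "\<dots> < s" using elim by (simp add: dist_norm field_simps)
    finally show ?case using s(2) by (meson ereal_less_eq(3) less_ereal.simps(1) less_trans)
  qed
qed

lemma frechet_subset_limiting_normal_cone:
  assumes "x \<in> S"
  shows "frechet_normal_cone S x \<subseteq> limiting_normal_cone S x"
  unfolding limiting_normal_cone_def
proof safe
  fix xs assume "xs \<in> frechet_normal_cone S x"
  then show "\<exists>p ps. p \<longlonglongrightarrow> x \<and> (\<forall>n. p n \<in> S) \<and>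
     (\<forall>v. (\<lambda>n. blinfun_apply (ps n) v) \<longlonglongrightarrow> blinfun_apply xs v) \<and>
     (\<forall>n. ps n \<in> frechet_normal_cone S (p n))"
    using assms by (intro exI[of _ "\<lambda>_. x"] exI[of _ "\<lambda>_. xs"]) auto
qed

section \<open>Penalization with a finite weight, and first-order conditions\<close>

text \<open>The points outside \<open>G\<close> with \<open>\<theta> \<le> 0\<close> form a compact
  set on which \<open>h\<close> is bounded away from 0, so a large weight makes the penalized value
  positive there, while it is at most 0 at \<open>z0\<close>. Landing in the open set
  \<open>G\<close> allows small perturbations of the minimizer.\<close>

lemma exact_penalty_compact:
  fixes \<theta> h :: "'z::t2_space \<Rightarrow> real"
  assumes D: "compact D" and cont: "continuous_on D \<theta>" "continuous_on D h"
    and h: "\<And>z. z \<in> D \<Longrightarrow> 0 \<le> h z"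
    and z0: "z0 \<in> D" "h z0 = 0" "\<theta> z0 \<le> 0"
    and G: "open G" "\<And>z. z \<in> D \<Longrightarrow> h z = 0 \<Longrightarrow> \<theta> z \<le> 0 \<Longrightarrow> z \<in> G"
  shows "\<exists>N>0. \<exists>z\<in>D \<inter> G. \<forall>z'\<in>D. \<theta> z + N * h z \<le> \<theta> z' + N * h z'"
proof -
  define E where "E = (D \<inter> \<theta> -` {..0}) - G"
  have "closedin (top_of_set D) (D \<inter> \<theta> -` {..0})"
    using cont(1) by (rule continuous_closedin_preimage) simp
  then have E: "compact E"
    unfolding E_def by (intro compact_diff[OF _ G(1)] closedin_compact[OF D])
  obtain \<mu> where \<mu>: "\<mu> > 0" "\<And>z. z \<in> E \<Longrightarrow> \<mu> \<le> h z"
  proof (cases "E = {}")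
    case True
    then show ?thesis using that[of 1] by simp
  next
    case False
    have "continuous_on E h" using cont(2) by (rule continuous_on_subset) (auto simp: E_def)
    then obtain e where e: "e \<in> E" "\<And>z. z \<in> E \<Longrightarrow> h e \<le> h z"
      using continuous_attains_inf[OF E False] by meson
    have "h e \<noteq> 0" using e(1) G(2)[of e] by (auto simp: E_def)
    then have "h e > 0" using h[of e] e(1) by (auto simp: E_def)
    then show ?thesis using e(2) by (rule that)
  qed
  have ne: "D \<noteq> {}" using z0(1) by auto
  obtain w where w: "w \<in> D" "\<And>z. z \<in> D \<Longrightarrow> \<theta> w \<le> \<theta> z"
    using continuous_attains_inf[OF D ne cont(1)] by meson
  \<comment> \<open>With \<open>\<theta> w\<close> the minimum of \<open>\<theta>\<close> on
    \<open>D\<close>, the penalized value on \<open>E\<close> is at least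
    \<open>\<theta> w + \<bar>\<theta> w\<bar> + 1 \<ge> 1\<close>.\<close>
  define N where "N = (\<bar>\<theta> w\<bar> + 1) / \<mu>"
  have N: "N > 0" using \<mu> by (simp add: N_def)
  have "continuous_on D (\<lambda>z. \<theta> z + N * h z)" by (intro continuous_intros cont)
  then obtain z where z: "z \<in> D" "\<And>z'. z' \<in> D \<Longrightarrow> \<theta> z + N * h z \<le> \<theta> z' + N * h z'"
    using continuous_attains_inf[OF D ne] by meson
  have le: "\<theta> z + N * h z \<le> 0" using z(2)[OF z0(1)] z0 by simp
  have "z \<in> G"
  proof (rule ccontr)
    assume "z \<notin> G"
    have "0 \<le> N * h z" using N h[OF z(1)] by simp
    then have "\<theta> z \<le> 0" using le by linarith
    then have "z \<in> E" using \<open>z \<notin> G\<close> z(1) by (simp add: E_def)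
    then have "N * \<mu> \<le> N * h z" using \<mu>(2) N by simp
    moreover have "N * \<mu> = \<bar>\<theta> w\<bar> + 1" using \<mu> by (simp add: N_def)
    ultimately show False using le w(2)[OF z(1)] by linarith
  qed
  then show ?thesis using N z by blast
qed

text \<open>Divide by \<open>t\<close> and let \<open>t\<close> tend to 0 from the right.\<close>

lemma nonneg_of_quadratic_perturbation:
  fixes A C t0 :: real
  assumes "0 < t0" "\<And>t. 0 < t \<Longrightarrow> t < t0 \<Longrightarrow> 0 \<le> t * A + t\<^sup>2 * C"
  shows "0 \<le> A"
proof -
  have "((\<lambda>t. A + t * C) \<longlongrightarrow> A + 0 * C) (at_right 0)" by (intro tendsto_intros)
  moreover have "\<forall>\<^sub>F t in at_right 0. 0 \<le> A + t * C"
    unfolding eventually_at_right_field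
  proof (intro exI[of _ t0] conjI allI impI assms(1))
    fix t assume t: "0 < t" "t < t0"
    have "0 \<le> t * (A + t * C)" using assms(2)[OF t] by (simp add: algebra_simps power2_eq_square)
    then show "0 \<le> A + t * C" using t by (simp add: zero_le_mult_iff)
  qed
  ultimately show ?thesis using tendsto_lowerbound[of "\<lambda>t. A + t * C" "A + 0 * C" "at_right 0" 0] by simp
qed

section \<open>Estimates for the inverse of \<open>phi\<close>\<close>

text \<open>The quotient \<open>\<delta> / (r - 2 * \<delta>)\<close> will be the localization
  radius in \<open>x\<close>; its bounds \<open>1/16\<close> and
  \<open>sqrt \<delta> - \<delta>\<close> match the two alternatives for the constants. The last
  inequality controls the perturbation of the multiplier. All of them become polynomial inequalities
  in \<open>s = sqrt (1 + r) - 1\<close>, in which \<open>r\<close>, \<open>\<delta>\<close> and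
  \<open>sqrt \<delta>\<close> are rational.\<close>

lemma phi_inv_bounds:
  assumes "0 < \<delta>" "\<delta> < 1/4"
  defines "r \<equiv> phi_inv \<delta>"
  shows "0 < r" "0 < r - 2 * \<delta>" "\<delta> / (r - 2 * \<delta>) < r" "\<delta> / (r - 2 * \<delta>) < 1/16"
    "\<delta> / (r - 2 * \<delta>) < sqrt \<delta> - \<delta>" "2 * \<delta> * (1 + r) \<le> r\<^sup>2"
proof -
  have "\<delta> \<in> phi ` {0..}" using phi_bij_betw assms by (simp add: bij_betw_def)
  then have r: "phi r = \<delta>" "0 \<le> r"
    unfolding r_def phi_inv_def
    using f_the_inv_into_f[OF strict_mono_on_imp_inj_on[OF phi_strict_mono_on]]
      the_inv_into_into[OF strict_mono_on_imp_inj_on[OF phi_strict_mono_on], of \<delta> "{0..}"] by auto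
  define s where "s = sqrt (1 + r) - 1"
  have s0: "s \<ge> 0" using r(2) by (simp add: s_def)
  have rs: "r = (s + 1)\<^sup>2 - 1" using r(2) by (simp add: s_def)
  have ds: "\<delta> = (s / (2 * (s + 1)))\<^sup>2"
  proof -
    have "\<delta> = 1/4 * (1 - 1 / (s + 1))\<^sup>2" using phi_eq[OF r(2)] r(1) by (simp add: s_def)
    also have "1 - 1 / (s + 1) = s / (s + 1)" using s0 by (simp add: field_simps)
    finally show ?thesis unfolding power_divide power_mult_distrib by simp
  qed
  have s: "s > 0" using s0 ds assms(1) by (cases "s = 0") auto
  have sq: "sqrt \<delta> = s / (2 * (s + 1))" using s by (simp add: ds)
  \<comment> \<open>The numerator of \<open>r - 2 * \<delta>\<close> over
    \<open>4 * (s + 1)\<^sup>2\<close>, without its factor \<open>s\<close>; the quotient to be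
    estimated is then \<open>s / m\<close>.\<close>
  define m where "m = 4 * (s + 1)\<^sup>2 * (s + 2) - 2 * s"
  have m: "m = 8 + 18 * s + 16 * s\<^sup>2 + 4 * s^3"
    unfolding m_def by (simp add: power2_eq_square power3_eq_cube algebra_simps)
  have mpos: "m \<ge> 8" using s unfolding m by simp
  have rd: "r - 2 * \<delta> = s * m / (4 * (s + 1)\<^sup>2)"
    unfolding m_def rs ds power_divide power_mult_distrib using s
    by (simp add: divide_simps) (simp add: power2_eq_square algebra_simps)
  show "0 < r" using s unfolding rs by (simp add: power2_eq_square algebra_simps add_pos_pos)
  show "0 < r - 2 * \<delta>" unfolding rd using s mpos by simp
  have q: "\<delta> / (r - 2 * \<delta>) = s / m"
  proof -
    define d where "d = 4 * (s + 1)\<^sup>2"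
    have "d > 0" using s by (simp add: d_def)
    moreover have "\<delta> = s * s / d"
      unfolding ds power_divide power_mult_distrib d_def by (simp add: power2_eq_square)
    ultimately show ?thesis unfolding rd d_def[symmetric] using s mpos by simp
  qed
  have "s / m \<le> s / 8" using s mpos by (intro divide_left_mono) auto
  also have "s / 8 < r" unfolding rs using s by (simp add: power2_eq_square algebra_simps add_pos_pos)
  finally show "\<delta> / (r - 2 * \<delta>) < r" unfolding q .
  have "16 * s < m" unfolding m using s by (simp add: add_pos_pos)
  then show "\<delta> / (r - 2 * \<delta>) < 1/16" unfolding q using mpos by (simp add: field_simps)
  have "sqrt \<delta> - \<delta> = s * (s + 2) / (4 * (s + 1)\<^sup>2)"
    unfolding sq unfolding ds power_divide power_mult_distrib using s
    by (simp add: divide_simps) (simp add: power2_eq_square algebra_simps)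
  moreover have "s / m < s * (s + 2) / (4 * (s + 1)\<^sup>2)"
  proof -
    \<comment> \<open>Cross-multiplied form of the claim; all coefficients are positive.\<close>
    have "(s + 2) * m - 4 * (s + 1)\<^sup>2 = 12 + 36 * s + 46 * s\<^sup>2 + 24 * s^3 + 4 * s^4"
      unfolding m by (simp add: power2_eq_square power3_eq_cube power4_eq_xxxx algebra_simps)
    also have "\<dots> > 0" using s by (intro add_pos_pos) auto
    finally have "s * (4 * (s + 1)\<^sup>2) < s * ((s + 2) * m)" using s by simp
    then show ?thesis using s mpos by (simp add: field_simps)
  qed
  ultimately show "\<delta> / (r - 2 * \<delta>) < sqrt \<delta> - \<delta>" unfolding q by simp
  have "2 * \<delta> * (1 + r) = s\<^sup>2 / 2"
    unfolding rs ds power_divide power_mult_distrib using s by (simp add: field_simps)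
  also have "\<dots> \<le> s\<^sup>2 * (s + 2)\<^sup>2"
  proof -
    have "1 * 1 \<le> (s + 2) * (s + 2)" using s by (intro mult_mono) auto
    then have "s\<^sup>2 * (1/2) \<le> s\<^sup>2 * (s + 2)\<^sup>2" by (intro mult_left_mono) (auto simp: power2_eq_square)
    then show ?thesis by simp
  qed
  also have "\<dots> = r\<^sup>2" unfolding rs by (simp add: power2_eq_square algebra_simps)
  finally show "2 * \<delta> * (1 + r) \<le> r\<^sup>2" .
qed

section \<open>Scaling of normals and rays contained in a set\<close>

lemma frechet_normal_cone_scaleR:
  assumes "xs \<in> frechet_normal_cone S x" "0 < s"
  shows "s *\<^sub>R xs \<in> frechet_normal_cone S x"
  unfolding frechet_normal_cone_def mem_Collect_eq Limsup_le_iff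
proof (intro allI impI)
  fix y :: ereal assume "y > 0"
  then obtain e where e: "0 < e" "ereal e < y" using ereal_dense2[of 0 y] by auto
  then have "ereal (e / s) > 0" using assms(2) by simp
  then have "\<forall>\<^sub>F u in at x within S. ereal (blinfun_apply xs (u - x) / norm (u - x)) < ereal (e / s)"
    using assms(1) unfolding frechet_normal_cone_def mem_Collect_eq Limsup_le_iff by blast
  then show "\<forall>\<^sub>F u in at x within S. ereal (blinfun_apply (s *\<^sub>R xs) (u - x) / norm (u - x)) < y"
  proof eventually_elim
    case (elim u)
    have "s * (blinfun_apply xs (u - x) / norm (u - x)) < s * (e / s)"
      using elim assms(2) by (intro mult_strict_left_mono) auto
    then have "ereal (blinfun_apply (s *\<^sub>R xs) (u - x) / norm (u - x)) < ereal e"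
      using assms(2) by (simp add: blinfun.scaleR_left)
    then show ?case using e(2) by (rule less_trans)
  qed
qed

lemma scaleR_frechet_mem_limiting_normal_cone:
  assumes "xs \<in> frechet_normal_cone S x" "0 < s" "x \<in> S"
  shows "s *\<^sub>R xs \<in> limiting_normal_cone S x"
  using frechet_normal_cone_scaleR[OF assms(1,2)] frechet_subset_limiting_normal_cone[OF assms(3)]
  by blast

lemma mem_scaled_unit_cball:
  fixes v :: "'a::real_normed_vector"
  assumes "norm v \<le> c" "0 < c"
  shows "v \<in> (\<lambda>b. c *\<^sub>R b) ` cball 0 1"
  using assms by (intro image_eqI[of _ _ "(1 / c) *\<^sub>R v"]) auto

text \<open>Along the ray the difference quotient has the constant value
  \<open>xs v / norm v\<close>. Applied to \<open>Gr K\<close>, this gives the sign of the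
  multiplier on \<open>P\<close>.\<close>

lemma frechet_normal_cone_ray:
  assumes "xs \<in> frechet_normal_cone S x" "\<And>t. 0 < t \<Longrightarrow> x + t *\<^sub>R v \<in> S"
  shows "blinfun_apply xs v \<le> 0"
proof (rule ccontr)
  assume "\<not> ?thesis"
  then have pos: "blinfun_apply xs v > 0" by simp
  then have v: "norm v > 0" by (auto simp: blinfun.zero_right)
  have "ereal (blinfun_apply xs v / norm v) > 0" using pos v by simp
  then have "\<forall>\<^sub>F u in at x within S.
      ereal (blinfun_apply xs (u - x) / norm (u - x)) < ereal (blinfun_apply xs v / norm v)"
    using assms(1) unfolding frechet_normal_cone_def mem_Collect_eq Limsup_le_iff by blast
  then obtain d where d: "d > 0" "\<And>u. u \<in> S \<Longrightarrow> u \<noteq> x \<Longrightarrow> dist u x < d \<Longrightarrow>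
      blinfun_apply xs (u - x) / norm (u - x) < blinfun_apply xs v / norm v"
    unfolding eventually_at by auto
  define t where "t = d / (2 * norm v)"
  have t: "t > 0" "t * norm v < d" using d(1) v by (auto simp: t_def)
  show False
    using d(2)[of "x + t *\<^sub>R v"] assms(2)[OF t(1)] t v by (auto simp: dist_norm blinfun.scaleR_right)
qed

lemma open_contains_short_step:
  fixes x v :: "'a::real_normed_vector"
  assumes "open U" "x \<in> U"
  obtains t0 where "0 < t0" "\<And>t. 0 < t \<Longrightarrow> t < t0 \<Longrightarrow> x + t *\<^sub>R v \<in> U"
proof -
  obtain e where e: "e > 0" "ball x e \<subseteq> U" using assms open_contains_ball by blast
  show ?thesis
  proof (rule that[of "e / (norm v + 1)"])
    show "0 < e / (norm v + 1)" using e by (simp add: add_nonneg_pos)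
    fix t assume t: "0 < t" "t < e / (norm v + 1)"
    then have "t * (norm v + 1) < e" by (simp add: pos_less_divide_eq add_nonneg_pos)
    then have "t * norm v < e" using t(1) by (simp add: distrib_left)
    then have "x + t *\<^sub>R v \<in> ball x e" using t(1) by (simp add: dist_norm)
    then show "x + t *\<^sub>R v \<in> U" using e(2) by blast
  qed
qed

section \<open>Multipliers from the decoupled minimization problem\<close>

text \<open>The strict inequalities for \<open>\<rho>\<close> and \<open>R\<close> leave a margin
  between the region that contains the feasible points with nonpositive objective and the boundary
  of the balls. A penalized minimizer is therefore interior to all the balls, and each of its
  components can be varied separately.\<close>

lemma approximate_multipliers:
  fixes F K :: "'a::real_normed_vector \<Rightarrow> 'b::real_normed_vector set"
  assumes fin_dim: "\<exists>B::'a set. finite B \<and> span B = UNIV" "\<exists>B::'b set. finite B \<and> span B = UNIV"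
    and cl: "closed \<Omega>" "closed (Gr F)" "closed (Gr K)"
    and base: "xb \<in> \<Omega>" "(xb, yb) \<in> Gr F" "(xb, 0) \<in> Gr K"
    and pos: "0 < \<delta>" "0 < \<gamma>" "0 < \<eta>" "\<delta> / \<gamma> < \<rho>" "\<delta> / \<eta> < R"
    and k: "norm k = 1"
    and lower: "\<forall>x\<in>\<Omega> \<inter> cball xb \<rho>. \<forall>y\<in>F x. \<forall>\<tau>. yb + \<tau> *\<^sub>R k - y \<in> K x \<longrightarrow> - \<delta> \<le> \<tau>"
  obtains x1 y1 x2 y2 x3 a1 b1 a2 b2 a3
  where "(x1, y1) \<in> Gr F \<inter> (ball xb \<rho> \<times> ball yb R)" "(x2, y2) \<in> Gr K \<inter> (ball xb \<rho> \<times> ball 0 R)"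
    "x3 \<in> \<Omega> \<inter> ball xb \<rho>"
    "dual_pair a1 b1 \<in> frechet_normal_cone (Gr F) (x1, y1)"
    "dual_pair a2 b2 \<in> frechet_normal_cone (Gr K) (x2, y2)"
    "a3 \<in> frechet_normal_cone \<Omega> x3"
    "norm (a1 + a2 + a3) \<le> \<gamma>" "norm (b1 - b2) \<le> 2 * \<eta>" "1 - \<eta> \<le> - blinfun_apply b2 k"
proof -
  have \<rho>: "\<rho> > 0" and R: "R > 0"
    using pos by (smt (verit) divide_pos_pos)+
  obtain \<beta> :: "'a \<Rightarrow> 'a \<Rightarrow> real" where \<beta>: "bounded_bilinear \<beta>" "\<And>u v. \<beta> u v = \<beta> v u"
      "\<And>v. v \<noteq> 0 \<Longrightarrow> 0 < \<beta> v v"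
    using positive_definite_form_finite_dimension[OF fin_dim(1)] by metis
  obtain \<kappa> :: "'b \<Rightarrow> 'b \<Rightarrow> real" where \<kappa>: "bounded_bilinear \<kappa>" "\<And>u v. \<kappa> u v = \<kappa> v u"
      "\<And>v. v \<noteq> 0 \<Longrightarrow> 0 < \<kappa> v v"
    using positive_definite_form_finite_dimension[OF fin_dim(2)] by metis
  interpret \<beta>: bounded_bilinear \<beta> by (rule \<beta>(1))
  interpret \<kappa>: bounded_bilinear \<kappa> by (rule \<kappa>(1))
  have \<beta>0: "0 \<le> \<beta> v v" and \<beta>z: "\<beta> v v = 0 \<longleftrightarrow> v = 0" for v
    using \<beta>(3)[of v] \<beta>.zero_left by (cases "v = 0"; simp)+
  have \<kappa>0: "0 \<le> \<kappa> v v" and \<kappa>z: "\<kappa> v v = 0 \<longleftrightarrow> v = 0" for v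
    using \<kappa>(3)[of v] \<kappa>.zero_left by (cases "v = 0"; simp)+
  have \<beta>add: "\<beta> (u + v) (u + v) = \<beta> u u + 2 * \<beta> u v + \<beta> v v" for u v
    by (simp add: \<beta>.add_left \<beta>.add_right \<beta>(2)[of v u])
  have \<kappa>add: "\<kappa> (u + v) (u + v) = \<kappa> u u + 2 * \<kappa> u v + \<kappa> v v" for u v
    by (simp add: \<kappa>.add_left \<kappa>.add_right \<kappa>(2)[of v u])
  obtain M1 where M1: "M1 > 0" "\<And>u v. norm (\<beta> u v) \<le> norm u * norm v * M1"
    using \<beta>.pos_bounded by blast
  obtain M2 where M2: "M2 > 0" "\<And>u v. norm (\<kappa> u v) \<le> norm u * norm v * M2"
    using \<kappa>.pos_bounded by blast
  define M where "M = max M1 M2"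
  have \<beta>M: "\<beta> v v \<le> M * (norm v)\<^sup>2" for v
  proof -
    have "\<beta> v v \<le> M1 * (norm v)\<^sup>2" using M1(2)[of v v] by (simp add: power2_eq_square mult_ac)
    also have "\<dots> \<le> M * (norm v)\<^sup>2" unfolding M_def by (intro mult_right_mono) auto
    finally show ?thesis .
  qed
  have \<kappa>M: "\<kappa> v v \<le> M * (norm v)\<^sup>2" for v
  proof -
    have "\<kappa> v v \<le> M2 * (norm v)\<^sup>2" using M2(2)[of v v] by (simp add: power2_eq_square mult_ac)
    also have "\<dots> \<le> M * (norm v)\<^sup>2" unfolding M_def by (intro mult_right_mono) auto
    finally show ?thesis .
  qed

  \<comment> \<open>The variables are a point of \<open>Gr F\<close>, a point of
    \<open>Gr K\<close>, a point of \<open>\<Omega>\<close>, and the shared \<open>x\<close>,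
    \<open>y\<close>, \<open>\<tau>\<close>. The vector \<open>w = yb + \<tau> k - y\<close> is not
    an independent variable. The objective depends on the shared variables only.\<close>
  define \<theta> :: "('a \<times> 'b) \<times> ('a \<times> 'b) \<times> 'a \<times> 'a \<times> 'b \<times> real \<Rightarrow> real" where
    "\<theta> = (\<lambda>((x1, y1), (x2, y2), x3, x, y, \<tau>).
       \<tau> + \<gamma> * norm (x - xb) + \<eta> * norm (y - yb) + \<eta> * norm (yb + \<tau> *\<^sub>R k - y))"
  define h :: "('a \<times> 'b) \<times> ('a \<times> 'b) \<times> 'a \<times> 'a \<times> 'b \<times> real \<Rightarrow> real" where
    "h = (\<lambda>((x1, y1), (x2, y2), x3, x, y, \<tau>).
       \<beta> (x1 - x) (x1 - x) + \<beta> (x2 - x) (x2 - x) + \<beta> (x3 - x) (x3 - x) + \<kappa> (y1 - y) (y1 - y)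
       + \<kappa> (y2 - (yb + \<tau> *\<^sub>R k - y)) (y2 - (yb + \<tau> *\<^sub>R k - y)))"
  \<comment> \<open>The radius \<open>\<delta> + 1\<close> for \<open>\<tau>\<close> keeps the
    relevant range \<open>- \<delta> \<le> \<tau> \<le> 0\<close> in the interior.\<close>
  define D where "D = (Gr F \<inter> (cball xb \<rho> \<times> cball yb R)) \<times> (Gr K \<inter> (cball xb \<rho> \<times> cball 0 R)) \<times>
      (\<Omega> \<inter> cball xb \<rho>) \<times> cball xb \<rho> \<times> cball yb R \<times> cball (0::real) (\<delta> + 1)"
  define G where "G = (ball xb \<rho> \<times> ball yb R) \<times> (ball xb \<rho> \<times> ball (0::'b) R) \<times>
      ball xb \<rho> \<times> ball xb \<rho> \<times> ball yb R \<times> ball (0::real) (\<delta> + 1)"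
  have compD: "compact D" unfolding D_def
    by (intro compact_Times closed_Int_compact cl compact_cball
         compact_cball_finite_dimension[OF fin_dim(1)] compact_cball_finite_dimension[OF fin_dim(2)])
  have openG: "open G" unfolding G_def by (intro open_Times open_ball)
  have cont\<theta>: "continuous_on D \<theta>" unfolding \<theta>_def case_prod_beta by (intro continuous_intros)
  have conth: "continuous_on D h" unfolding h_def case_prod_beta
    by (intro continuous_intros \<beta>.continuous_on \<kappa>.continuous_on)
  have h0: "0 \<le> h z" for z
    unfolding h_def case_prod_beta using \<beta>0 \<kappa>0 by simp
  have z0D: "((xb, yb), (xb, 0), xb, xb, yb, 0) \<in> D" (is "?z0 \<in> D")
    unfolding D_def using base \<rho> R pos(1) by simp
  have z0: "h ?z0 = 0" "\<theta> ?z0 \<le> 0"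
    by (simp_all add: h_def \<theta>_def \<beta>.zero_left \<kappa>.zero_left)
  \<comment> \<open>Zero penalty merges all the copies, so \<open>lower\<close> applies and gives
    \<open>- \<tau> \<le> \<delta>\<close>; each norm term of the objective is then at most
    \<open>\<delta>\<close>.\<close>
  have inG: "z \<in> G" if z: "z \<in> D" "h z = 0" "\<theta> z \<le> 0" for z
  proof -
    obtain x1 y1 x2 y2 x3 x y \<tau> where zz: "z = ((x1, y1), (x2, y2), x3, x, y, \<tau>)"
      by (metis prod.exhaust)
    define w where "w = yb + \<tau> *\<^sub>R k - y"
    have "\<beta> (x1 - x) (x1 - x) + \<beta> (x2 - x) (x2 - x) + \<beta> (x3 - x) (x3 - x) + \<kappa> (y1 - y) (y1 - y)
       + \<kappa> (y2 - w) (y2 - w) = 0"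
      using z(2) unfolding zz h_def w_def by simp
    then have "\<beta> (x1 - x) (x1 - x) = 0" "\<beta> (x2 - x) (x2 - x) = 0" "\<beta> (x3 - x) (x3 - x) = 0"
        "\<kappa> (y1 - y) (y1 - y) = 0" "\<kappa> (y2 - w) (y2 - w) = 0"
      using \<beta>0[of "x1 - x"] \<beta>0[of "x2 - x"] \<beta>0[of "x3 - x"] \<kappa>0[of "y1 - y"] \<kappa>0[of "y2 - w"]
      by linarith+
    then have eq: "x1 = x" "x2 = x" "x3 = x" "y1 = y" "y2 = w" by (auto simp: \<beta>z \<kappa>z)
    have mem: "x \<in> \<Omega> \<inter> cball xb \<rho>" "y \<in> F x" "w \<in> K x"
      using z(1) unfolding zz eq D_def by (auto simp: Gr_def)
    have \<tau>: "- \<delta> \<le> \<tau>" using lower mem unfolding w_def by blast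
    have th: "\<tau> + \<gamma> * norm (x - xb) + \<eta> * norm (y - yb) + \<eta> * norm w \<le> 0"
      using z(3) unfolding zz \<theta>_def w_def by simp
    have nn: "0 \<le> \<gamma> * norm (x - xb)" "0 \<le> \<eta> * norm (y - yb)" "0 \<le> \<eta> * norm w"
      using pos by simp_all
    have "\<gamma> * norm (x - xb) \<le> \<delta>" "\<eta> * norm (y - yb) \<le> \<delta>" "\<eta> * norm w \<le> \<delta>" "\<tau> \<le> 0"
      using th nn \<tau> by linarith+
    then have "norm (x - xb) \<le> \<delta> / \<gamma>" "norm (y - yb) \<le> \<delta> / \<eta>" "norm w \<le> \<delta> / \<eta>" "\<tau> \<le> 0"
      using pos by (auto simp: pos_le_divide_eq mult.commute)
    then have "norm (x - xb) < \<rho>" "norm (y - yb) < R" "norm w < R" "\<bar>\<tau>\<bar> < \<delta> + 1"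
      using pos \<tau> by linarith+
    then show ?thesis unfolding zz eq G_def by (simp add: dist_norm norm_minus_commute)
  qed
  obtain N z where N: "0 < N" and z: "z \<in> D \<inter> G"
    and zmin: "\<And>z'. z' \<in> D \<Longrightarrow> \<theta> z + N * h z \<le> \<theta> z' + N * h z'"
    using exact_penalty_compact[OF compD cont\<theta> conth h0 z0D z0 openG inG] by blast
  obtain x1 y1 x2 y2 x3 x y \<tau> where zz: "z = ((x1, y1), (x2, y2), x3, x, y, \<tau>)"
    by (metis prod.exhaust)
  define w where "w = yb + \<tau> *\<^sub>R k - y"
  have m1: "(x1, y1) \<in> Gr F" "x1 \<in> ball xb \<rho>" "y1 \<in> ball yb R"
    and m2: "(x2, y2) \<in> Gr K" "x2 \<in> ball xb \<rho>" "y2 \<in> ball 0 R"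
    and m3: "x3 \<in> \<Omega>" "x3 \<in> ball xb \<rho>"
    and m4: "x \<in> ball xb \<rho>" "y \<in> ball yb R" "\<tau> \<in> ball 0 (\<delta> + 1)"
    using z unfolding zz D_def G_def by auto
  have min: "\<tau> + \<gamma> * norm (x - xb) + \<eta> * norm (y - yb) + \<eta> * norm w + N * (
       \<beta> (x1 - x) (x1 - x) + \<beta> (x2 - x) (x2 - x) + \<beta> (x3 - x) (x3 - x) + \<kappa> (y1 - y) (y1 - y)
       + \<kappa> (y2 - w) (y2 - w)) \<le>
     \<tau>' + \<gamma> * norm (x' - xb) + \<eta> * norm (y' - yb) + \<eta> * norm (yb + \<tau>' *\<^sub>R k - y') + N * (
       \<beta> (x1' - x') (x1' - x') + \<beta> (x2' - x') (x2' - x') + \<beta> (x3' - x') (x3' - x') + \<kappa> (y1' - y') (y1' - y')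
       + \<kappa> (y2' - (yb + \<tau>' *\<^sub>R k - y')) (y2' - (yb + \<tau>' *\<^sub>R k - y')))"
    if "(x1', y1') \<in> Gr F" "(x2', y2') \<in> Gr K" "x3' \<in> \<Omega>" "x1' \<in> ball xb \<rho>" "y1' \<in> ball yb R"
      "x2' \<in> ball xb \<rho>" "y2' \<in> ball 0 R" "x3' \<in> ball xb \<rho>" "x' \<in> ball xb \<rho>" "y' \<in> ball yb R"
      "\<tau>' \<in> ball 0 (\<delta> + 1)" for x1' y1' x2' y2' x3' x' y' \<tau>'
    using zmin[of "((x1', y1'), (x2', y2'), x3', x', y', \<tau>')"] that
    unfolding zz D_def \<theta>_def h_def w_def by simp

  define LX where "LX u = Blinfun (\<beta> u)" for u
  define LY where "LY u = Blinfun (\<kappa> u)" for u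
  have LX: "blinfun_apply (LX u) v = \<beta> u v" for u v
    unfolding LX_def by (simp add: bounded_linear_Blinfun_apply \<beta>.bounded_linear_right)
  have LY: "blinfun_apply (LY u) v = \<kappa> u v" for u v
    unfolding LY_def by (simp add: bounded_linear_Blinfun_apply \<kappa>.bounded_linear_right)
  \<comment> \<open>These are the negatives of the partial derivatives of the penalty at the five
    decoupled components; the minus sign turns minimality into normality.\<close>
  define a1 where "a1 = (- (2 * N)) *\<^sub>R LX (x1 - x)"
  define a2 where "a2 = (- (2 * N)) *\<^sub>R LX (x2 - x)"
  define a3 where "a3 = (- (2 * N)) *\<^sub>R LX (x3 - x)"
  define b1 where "b1 = (- (2 * N)) *\<^sub>R LY (y1 - y)"
  define b2 where "b2 = (- (2 * N)) *\<^sub>R LY (y2 - w)"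
  note abs_defs = a1_def a2_def a3_def b1_def b2_def blinfun.scaleR_left blinfun.add_left
    blinfun.diff_left blinfun.minus_left LX LY

  \<comment> \<open>If a displacement does not lower the penalty, its linear part is controlled by
    the quadratic remainder, as \<open>frechet_normal_coneI\<close> requires.\<close>
  have pairbound: "- (2 * N * \<beta> u dx) - 2 * N * \<kappa> v dy \<le> N * M * (norm (dx, dy))\<^sup>2"
    if "N * (\<beta> u u + \<kappa> v v) \<le> N * (\<beta> (u + dx) (u + dx) + \<kappa> (v + dy) (v + dy))" for u dx v dy
  proof -
    have "\<beta> u u + \<kappa> v v \<le> \<beta> (u + dx) (u + dx) + \<kappa> (v + dy) (v + dy)" using that N by simp
    then have "- (2 * \<beta> u dx) - 2 * \<kappa> v dy \<le> \<beta> dx dx + \<kappa> dy dy"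
      unfolding \<beta>add \<kappa>add by simp
    also have "\<dots> \<le> M * (norm (dx, dy))\<^sup>2"
      using \<beta>M[of dx] \<kappa>M[of dy] by (simp add: norm_Pair distrib_left)
    finally have "N * (- (2 * \<beta> u dx) - 2 * \<kappa> v dy) \<le> N * (M * (norm (dx, dy))\<^sup>2)"
      using N by (intro mult_left_mono) auto
    then show ?thesis by (simp add: algebra_simps)
  qed

  obtain e1 where e1: "e1 > 0" "ball (x1, y1) e1 \<subseteq> ball xb \<rho> \<times> ball yb R"
    using openE[OF open_Times[OF open_ball open_ball] SigmaI[OF m1(2,3)]] by blast
  have n1: "dual_pair a1 b1 \<in> frechet_normal_cone (Gr F) (x1, y1)"
  proof (rule frechet_normal_coneI[OF e1(1), where C = "N * M"])
    fix u assume u: "u \<in> Gr F" "dist u (x1, y1) < e1"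
    obtain x1' y1' where uu: "u = (x1', y1')" by (cases u)
    have "(x1', y1') \<in> ball xb \<rho> \<times> ball yb R" using u(2) e1(2) unfolding uu by (auto simp: dist_commute)
    \<comment> \<open>Only the point of \<open>Gr F\<close> moves, so all other terms cancel in the
      minimality inequality.\<close>
    then have "N * (\<beta> (x1 - x) (x1 - x) + \<kappa> (y1 - y) (y1 - y)) \<le> N * (\<beta> (x1' - x) (x1' - x) + \<kappa> (y1' - y) (y1' - y))"
      using min[of x1' y1' x2 y2 x3 x y \<tau>] u(1) m1 m2 m3 m4 unfolding uu w_def[symmetric]
      by (simp add: distrib_left)
    then show "blinfun_apply (dual_pair a1 b1) (u - (x1, y1)) \<le> N * M * (norm (u - (x1, y1)))\<^sup>2"
      using pairbound[of "x1 - x" "y1 - y" "x1' - x1" "y1' - y1"]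
      by (simp add: uu dual_pair_apply abs_defs)
  qed
  obtain e2 where e2: "e2 > 0" "ball (x2, y2) e2 \<subseteq> ball xb \<rho> \<times> ball 0 R"
    using openE[OF open_Times[OF open_ball open_ball] SigmaI[OF m2(2,3)]] by blast
  have n2: "dual_pair a2 b2 \<in> frechet_normal_cone (Gr K) (x2, y2)"
  proof (rule frechet_normal_coneI[OF e2(1), where C = "N * M"])
    fix u assume u: "u \<in> Gr K" "dist u (x2, y2) < e2"
    obtain x2' y2' where uu: "u = (x2', y2')" by (cases u)
    have "(x2', y2') \<in> ball xb \<rho> \<times> ball 0 R" using u(2) e2(2) unfolding uu by (auto simp: dist_commute)
    then have "N * (\<beta> (x2 - x) (x2 - x) + \<kappa> (y2 - w) (y2 - w)) \<le> N * (\<beta> (x2' - x) (x2' - x) + \<kappa> (y2' - w) (y2' - w))"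
      using min[of x1 y1 x2' y2' x3 x y \<tau>] u(1) m1 m2 m3 m4 unfolding uu w_def[symmetric]
      by (simp add: distrib_left)
    then show "blinfun_apply (dual_pair a2 b2) (u - (x2, y2)) \<le> N * M * (norm (u - (x2, y2)))\<^sup>2"
      using pairbound[of "x2 - x" "y2 - w" "x2' - x2" "y2' - y2"]
      by (simp add: uu dual_pair_apply abs_defs)
  qed
  obtain e3 where e3: "e3 > 0" "ball x3 e3 \<subseteq> ball xb \<rho>"
    using openE[OF open_ball m3(2)] by blast
  have n3: "a3 \<in> frechet_normal_cone \<Omega> x3"
  proof (rule frechet_normal_coneI[OF e3(1), where C = "N * M"])
    fix u assume u: "u \<in> \<Omega>" "dist u x3 < e3"
    have "u \<in> ball xb \<rho>" using u(2) by (intro subsetD[OF e3(2)]) (simp add: dist_commute)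
    then have "N * \<beta> (x3 - x) (x3 - x) \<le> N * \<beta> (u - x) (u - x)"
      using min[of x1 y1 x2 y2 u x y \<tau>] u(1) m1 m2 m3 m4 unfolding w_def[symmetric]
      by (simp add: distrib_left)
    then show "blinfun_apply a3 (u - x3) \<le> N * M * (norm (u - x3))\<^sup>2"
      using pairbound[of "x3 - x" 0 "u - x3" 0]
      by (simp add: abs_defs \<kappa>.zero_left norm_Pair)
  qed

  \<comment> \<open>Stationarity in \<open>x\<close>: the free variable moves in direction
    \<open>v\<close>, which affects three penalty terms and one norm term. Using both
    \<open>v\<close> and \<open>- v\<close> bounds the sum of the three functionals.\<close>
  have "2 * N * (\<beta> (x1 - x) v + \<beta> (x2 - x) v + \<beta> (x3 - x) v) \<le> \<gamma> * norm v" for v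
  proof -
    obtain t0 where t0: "0 < t0" "\<And>t. 0 < t \<Longrightarrow> t < t0 \<Longrightarrow> x + t *\<^sub>R v \<in> ball xb \<rho>"
      using open_contains_short_step[OF open_ball m4(1)] by metis
    have "0 \<le> \<gamma> * norm v - 2 * N * (\<beta> (x1 - x) v + \<beta> (x2 - x) v + \<beta> (x3 - x) v)"
    proof (rule nonneg_of_quadratic_perturbation[OF t0(1), where C = "3 * N * \<beta> v v"])
      fix t assume t: "0 < t" "t < t0"
      have q: "\<beta> (p - (x + t *\<^sub>R v)) (p - (x + t *\<^sub>R v)) =
          \<beta> (p - x) (p - x) - 2 * t * \<beta> (p - x) v + t\<^sup>2 * \<beta> v v" for p
        using \<beta>add[of "p - x" "(- t) *\<^sub>R v"]
        by (simp add: \<beta>.scaleR_left \<beta>.scaleR_right \<beta>.minus_left \<beta>.minus_right power2_eq_square diff_diff_eq)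
      have "norm (x + t *\<^sub>R v - xb) \<le> norm (x - xb) + t * norm v"
        using norm_triangle_ineq[of "x - xb" "t *\<^sub>R v"] t by (simp add: algebra_simps)
      then have "\<gamma> * norm (x + t *\<^sub>R v - xb) \<le> \<gamma> * (norm (x - xb) + t * norm v)"
        using pos by simp
      then show "0 \<le> t * (\<gamma> * norm v - 2 * N * (\<beta> (x1 - x) v + \<beta> (x2 - x) v + \<beta> (x3 - x) v))
          + t\<^sup>2 * (3 * N * \<beta> v v)"
        using min[of x1 y1 x2 y2 x3 "x + t *\<^sub>R v" y \<tau>] t0(2)[OF t] m1 m2 m3 m4
        unfolding w_def[symmetric] q by (simp add: algebra_simps)
    qed
    then show ?thesis by simp
  qed
  note stationary_x = this
  have bound1: "norm (a1 + a2 + a3) \<le> \<gamma>"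
  proof (rule norm_blinfun_bound)
    fix v
    show "norm (blinfun_apply (a1 + a2 + a3) v) \<le> \<gamma> * norm v"
      using stationary_x[of v] stationary_x[of "- v"] by (simp add: abs_defs \<beta>.minus_right algebra_simps)
  qed (use pos in simp)

  \<comment> \<open>Stationarity in \<open>y\<close>: moving \<open>y\<close> by \<open>t v\<close>
    moves \<open>w\<close> by \<open>- t v\<close>. Hence the difference of the functionals, and the
    factor 2 from two norm terms.\<close>
  have "2 * N * (\<kappa> (y1 - y) v - \<kappa> (y2 - w) v) \<le> 2 * \<eta> * norm v" for v
  proof -
    obtain t0 where t0: "0 < t0" "\<And>t. 0 < t \<Longrightarrow> t < t0 \<Longrightarrow> y + t *\<^sub>R v \<in> ball yb R"
      using open_contains_short_step[OF open_ball m4(2)] by metis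
    have "0 \<le> 2 * \<eta> * norm v - 2 * N * (\<kappa> (y1 - y) v - \<kappa> (y2 - w) v)"
    proof (rule nonneg_of_quadratic_perturbation[OF t0(1), where C = "2 * N * \<kappa> v v"])
      fix t assume t: "0 < t" "t < t0"
      have q1: "\<kappa> (y1 - (y + t *\<^sub>R v)) (y1 - (y + t *\<^sub>R v)) =
          \<kappa> (y1 - y) (y1 - y) - 2 * t * \<kappa> (y1 - y) v + t\<^sup>2 * \<kappa> v v"
        using \<kappa>add[of "y1 - y" "(- t) *\<^sub>R v"]
        by (simp add: \<kappa>.scaleR_left \<kappa>.scaleR_right \<kappa>.minus_left \<kappa>.minus_right power2_eq_square diff_diff_eq)
      have w: "yb + \<tau> *\<^sub>R k - (y + t *\<^sub>R v) = w - t *\<^sub>R v" by (simp add: w_def)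
      have q2: "\<kappa> (y2 - (w - t *\<^sub>R v)) (y2 - (w - t *\<^sub>R v)) =
          \<kappa> (y2 - w) (y2 - w) + 2 * t * \<kappa> (y2 - w) v + t\<^sup>2 * \<kappa> v v"
        using \<kappa>add[of "y2 - w" "t *\<^sub>R v"]
        by (simp add: \<kappa>.scaleR_left \<kappa>.scaleR_right power2_eq_square algebra_simps)
      have "norm (y + t *\<^sub>R v - yb) \<le> norm (y - yb) + t * norm v"
        using norm_triangle_ineq[of "y - yb" "t *\<^sub>R v"] t by (simp add: algebra_simps)
      then have i1: "\<eta> * norm (y + t *\<^sub>R v - yb) \<le> \<eta> * (norm (y - yb) + t * norm v)"
        using pos by simp
      have "norm (w - t *\<^sub>R v) \<le> norm w + t * norm v"
        using norm_triangle_ineq4[of w "t *\<^sub>R v"] t by simp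
      then have i2: "\<eta> * norm (w - t *\<^sub>R v) \<le> \<eta> * (norm w + t * norm v)"
        using pos by simp
      show "0 \<le> t * (2 * \<eta> * norm v - 2 * N * (\<kappa> (y1 - y) v - \<kappa> (y2 - w) v)) + t\<^sup>2 * (2 * N * \<kappa> v v)"
        using min[of x1 y1 x2 y2 x3 x "y + t *\<^sub>R v" \<tau>] t0(2)[OF t] m1 m2 m3 m4 i1 i2
        unfolding w q1 q2 by (simp add: algebra_simps)
    qed
    then show ?thesis by simp
  qed
  note stationary_y = this
  have bound2: "norm (b1 - b2) \<le> 2 * \<eta>"
  proof (rule norm_blinfun_bound)
    fix v
    show "norm (blinfun_apply (b1 - b2) v) \<le> 2 * \<eta> * norm v"
      using stationary_y[of v] stationary_y[of "- v"] by (simp add: abs_defs \<kappa>.minus_right algebra_simps)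
  qed (use pos in simp)

  \<comment> \<open>Stationarity in \<open>\<tau>\<close>, tested by decreasing it: the objective
    gains \<open>t\<close> and loses at most \<open>\<eta> * t\<close> because
    \<open>norm k = 1\<close>. The penalty must compensate, which bounds the multiplier at
    \<open>k\<close> from below.\<close>
  obtain t0 where t0: "0 < t0" "\<And>t. 0 < t \<Longrightarrow> t < t0 \<Longrightarrow> \<tau> + t *\<^sub>R (- 1) \<in> ball 0 (\<delta> + 1)"
    using open_contains_short_step[OF open_ball m4(3)] by metis
  have "0 \<le> 2 * N * \<kappa> (y2 - w) k - (1 - \<eta>)"
  proof (rule nonneg_of_quadratic_perturbation[OF t0(1), where C = "N * \<kappa> k k"])
    fix t assume t: "0 < t" "t < t0"
    have w: "yb + (\<tau> - t) *\<^sub>R k - y = w - t *\<^sub>R k" by (simp add: w_def algebra_simps)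
    have q2: "\<kappa> (y2 - (w - t *\<^sub>R k)) (y2 - (w - t *\<^sub>R k)) =
        \<kappa> (y2 - w) (y2 - w) + 2 * t * \<kappa> (y2 - w) k + t\<^sup>2 * \<kappa> k k"
      using \<kappa>add[of "y2 - w" "t *\<^sub>R k"]
      by (simp add: \<kappa>.scaleR_left \<kappa>.scaleR_right power2_eq_square algebra_simps)
    have "norm (w - t *\<^sub>R k) \<le> norm w + t"
      using norm_triangle_ineq4[of w "t *\<^sub>R k"] t k by simp
    then have i2: "\<eta> * norm (w - t *\<^sub>R k) \<le> \<eta> * (norm w + t)"
      using pos by simp
    show "0 \<le> t * (2 * N * \<kappa> (y2 - w) k - (1 - \<eta>)) + t\<^sup>2 * (N * \<kappa> k k)"
      using min[of x1 y1 x2 y2 x3 x y "\<tau> - t"] t0(2)[OF t] m1 m2 m3 m4 i2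
      unfolding w q2 by (simp add: algebra_simps)
  qed
  then have bound3: "1 - \<eta> \<le> - blinfun_apply b2 k" by (simp add: abs_defs)
  show ?thesis
    using m1 m2 m3 by (intro that[OF _ _ _ n1 n2 n3 bound1 bound2 bound3]) auto
qed

section \<open>Nondominatedness as a lower bound, and normalization of the multipliers\<close>

lemma scaleR_dual_pair: "s *\<^sub>R dual_pair xs ys = dual_pair (s *\<^sub>R xs) (s *\<^sub>R ys)"
  by (rule blinfun_eqI) (auto simp: dual_pair_apply blinfun.scaleR_left distrib_left)

theorem theorem4p10:
  fixes \<Omega> :: "'a::real_normed_vector set"
    and F K :: "'a \<Rightarrow> 'b::real_normed_vector set"
    and xb :: 'a and yb k :: 'b
    and \<epsilon> :: ereal and \<delta> :: real
    and P :: "'b set"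
  assumes fin_dim_X: "\<exists>B::'a set. finite B \<and> span B = UNIV"
    and fin_dim_Y: "\<exists>B::'b set. finite B \<and> span B = UNIV"
    and closed_Omega: "closed \<Omega>"
    and closed_F: "closed (Gr F)"
    and closed_K: "closed (Gr K)"
    and K: "variable_domination_structure K"
    and base: "xb \<in> \<Omega>" "(xb, yb) \<in> Gr F" "(xb, 0) \<in> Gr K"
    and aubin: "aubin_property F xb yb" "aubin_property K xb 0"
    and constants: "0 < \<epsilon>" "0 < \<delta>"
      "(\<epsilon> > ereal (1/16) \<and> \<delta> < 1/4) \<or>
       (\<delta> < 1/4 \<and> ereal \<delta> < \<epsilon> \<and> ereal (sqrt \<delta> - \<delta>) < \<epsilon>)"
    and P_def: "P = (\<Inter>x \<in> eball xb \<epsilon>. K x)"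
    and k: "k \<in> sphere 0 1 \<inter> interior P"
    and nondominated: "nondominated_solution \<epsilon> \<delta> k K F \<Omega> xb yb"
  shows "\<exists>ys x1 y1 x2 y2 x3 zs.
     ys \<in> positive_dual P \<and> blinfun_apply ys k = 1 \<and>
     (x1, y1) \<in> Gr F \<inter> (cball xb (phi_inv \<delta>) \<times> cball yb (phi_inv \<delta>)) \<and>
     (x2, y2) \<in> Gr K \<inter> (cball xb (phi_inv \<delta>) \<times> cball 0 (phi_inv \<delta>)) \<and>
     x3 \<in> \<Omega> \<inter> cball xb (phi_inv \<delta>) \<and>
     zs \<in> (\<lambda>b. (2 * phi_inv \<delta>) *\<^sub>R b) ` cball 0 1 \<and>
     0 \<in> coderivative F x1 y1 (ys - zs) + coderivative K x2 y2 ys +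
         limiting_normal_cone \<Omega> x3 + (\<lambda>b. phi_inv \<delta> *\<^sub>R b) ` cball 0 1"
proof -
  define r where "r = phi_inv \<delta>"
  \<comment> \<open>With these weights \<open>\<gamma> / (1 - \<eta>) = r\<close> and \<open>2 * \<eta> / (1 - \<eta>) \<le> 2 * r\<close>, the two radii required
    after normalization.\<close>
  define \<gamma> where "\<gamma> = r - 2 * \<delta>"
  define \<eta> where "\<eta> = 2 * \<delta> / r"
  have \<delta>: "0 < \<delta>" "\<delta> < 1/4" using constants by auto
  note bounds = phi_inv_bounds[OF \<delta>, folded r_def, folded \<gamma>_def]
  have r: "r > 0" by (rule bounds(1))
  have \<gamma>: "\<gamma> > 0" by (rule bounds(2))
  have \<eta>: "0 < \<eta>" "\<eta> < 1" "\<delta> / \<eta> < r" "\<gamma> = r * (1 - \<eta>)" "\<eta> \<le> r * (1 - \<eta>)"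
    using \<delta> r \<gamma> bounds(6) by (auto simp: \<eta>_def \<gamma>_def field_simps power2_eq_square)

  have "ereal (\<delta> / \<gamma>) < \<epsilon>"
    using constants(3)
  proof
    assume "ereal (1/16) < \<epsilon> \<and> \<delta> < 1/4"
    moreover have "ereal (\<delta> / \<gamma>) < ereal (1/16)" using bounds(4) by simp
    ultimately show ?thesis using less_trans by blast
  next
    assume "\<delta> < 1/4 \<and> ereal \<delta> < \<epsilon> \<and> ereal (sqrt \<delta> - \<delta>) < \<epsilon>"
    moreover have "ereal (\<delta> / \<gamma>) < ereal (sqrt \<delta> - \<delta>)" using bounds(5) by simp
    ultimately show ?thesis using less_trans by blast
  qed
  then have "ereal (\<delta> / \<gamma>) < min (ereal r) \<epsilon>" using bounds(3) by simp
  \<comment> \<open>A real radius, even if \<open>\<epsilon>\<close> is infinite: large enough to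
    localize the minimizers, and small enough that \<open>cball xb \<rho>\<close> stays in
    \<open>eball xb \<epsilon>\<close>, where \<open>P \<subseteq> K x\<close>.\<close>
  then obtain \<rho> where \<rho>: "\<delta> / \<gamma> < \<rho>" "\<rho> < r" "ereal \<rho> < \<epsilon>"
    using ereal_dense2[of "ereal (\<delta> / \<gamma>)" "min (ereal r) \<epsilon>"] by auto
  have eball: "x \<in> eball xb \<epsilon>" if "dist xb x \<le> \<rho>" for x
    using that \<rho>(3) by (auto simp: eball_def intro: le_less_trans[of _ "ereal \<rho>"])

  have cone_K: "cone (K x)" and add_K: "\<And>p q. p \<in> K x \<Longrightarrow> q \<in> K x \<Longrightarrow> p + q \<in> K x"
    and pointed_K: "K x \<inter> uminus ` K x = {0}" for x
    using K convex_cone[of "K x"]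
    by (auto simp: variable_domination_structure_def proper_cone_def pointed_def)
  have kP: "k \<in> K x" if "x \<in> eball xb \<epsilon>" for x
    using k that interior_subset[of P] unfolding P_def by blast
  have norm_k: "norm k = 1" using k by simp

  \<comment> \<open>If \<open>\<tau> < - \<delta>\<close>, adding the positive multiple
    \<open>(- \<delta> - \<tau>) k\<close> stays in \<open>K x\<close> and exhibits the negative of
    a point of the translated image. Nondominatedness makes that point 0, and pointedness then
    forces \<open>k = 0\<close>.\<close>
  have "- \<delta> \<le> \<tau>"
    if x: "x \<in> \<Omega>" "dist xb x \<le> \<rho>" and y: "y \<in> F x" and w: "yb + \<tau> *\<^sub>R k - y \<in> K x" for x y \<tau>
  proof (rule ccontr)
    assume "\<not> - \<delta> \<le> \<tau>"
    then have t: "- \<delta> - \<tau> > 0" by simp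
    define v where "v = yb - \<delta> *\<^sub>R k - y"
    have tk: "(- \<delta> - \<tau>) *\<^sub>R k \<in> K x"
      using kP[OF eball[OF x(2)]] cone_K[of x] t unfolding cone_def by simp
    have "v = (yb + \<tau> *\<^sub>R k - y) + (- \<delta> - \<tau>) *\<^sub>R k"
      by (simp add: v_def algebra_simps)
    then have "v \<in> K x" using add_K w tk by simp
    moreover have "- v = y - yb + \<delta> *\<^sub>R k" by (simp add: v_def)
    ultimately have "- v \<in> (\<lambda>y. y - yb + \<delta> *\<^sub>R k) ` F x \<inter> uminus ` K x"
      using y by (intro IntI) (blast, rule imageI)
    then have "v = 0"
      using nondominated x eball[OF x(2)] unfolding nondominated_solution_def by fastforce
    then have "(- \<delta> - \<tau>) *\<^sub>R k = - (yb + \<tau> *\<^sub>R k - y)" by (simp add: v_def algebra_simps)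
    then have "(- \<delta> - \<tau>) *\<^sub>R k \<in> uminus ` K x" using w by (rule image_eqI)
    with tk have "(- \<delta> - \<tau>) *\<^sub>R k \<in> K x \<inter> uminus ` K x" by (rule IntI)
    then have "(- \<delta> - \<tau>) *\<^sub>R k = 0" using pointed_K by blast
    then show False using t norm_k by auto
  qed

  then have "\<forall>x\<in>\<Omega> \<inter> cball xb \<rho>. \<forall>y\<in>F x. \<forall>\<tau>. yb + \<tau> *\<^sub>R k - y \<in> K x \<longrightarrow> - \<delta> \<le> \<tau>"
    by auto
  then obtain x1 y1 x2 y2 x3 a1 b1 a2 b2 a3 where
    m: "(x1, y1) \<in> Gr F \<inter> (ball xb \<rho> \<times> ball yb r)" "(x2, y2) \<in> Gr K \<inter> (ball xb \<rho> \<times> ball 0 r)"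
      "x3 \<in> \<Omega> \<inter> ball xb \<rho>"
    and n: "dual_pair a1 b1 \<in> frechet_normal_cone (Gr F) (x1, y1)"
      "dual_pair a2 b2 \<in> frechet_normal_cone (Gr K) (x2, y2)"
      "a3 \<in> frechet_normal_cone \<Omega> x3"
    and b: "norm (a1 + a2 + a3) \<le> \<gamma>" "norm (b1 - b2) \<le> 2 * \<eta>" "1 - \<eta> \<le> - blinfun_apply b2 k"
    by (rule approximate_multipliers[OF fin_dim_X fin_dim_Y closed_Omega closed_F closed_K base
        \<delta>(1) \<gamma> \<eta>(1) \<rho>(1) \<eta>(3) norm_k])

  \<comment> \<open>Chosen so that \<open>ys k = 1\<close>; the lower bound on \<open>- b2 k\<close>
    gives \<open>s \<le> 1 / (1 - \<eta>)\<close>.\<close>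
  define s where "s = 1 / (- blinfun_apply b2 k)"
  have s: "0 < s" "s * (1 - \<eta>) \<le> 1" "s * blinfun_apply b2 k = - 1"
    using b(3) \<eta>(2) by (auto simp: s_def field_simps)
  have sr: "s * (r * (1 - \<eta>)) \<le> r" using mult_left_mono[OF s(2), of r] r by (simp add: mult_ac)
  define ys where "ys = - (s *\<^sub>R b2)"
  define zs where "zs = s *\<^sub>R (b1 - b2)"
  define rest where "rest = - (s *\<^sub>R (a1 + a2 + a3))"
  note limiting = scaleR_frechet_mem_limiting_normal_cone[OF _ s(1)]

  \<comment> \<open>Here \<open>ys - zs = - s b1\<close>, so the sign in the coderivative restores
    \<open>s b1\<close>; \<open>zs\<close> absorbs the mismatch between \<open>b1\<close> and
    \<open>b2\<close>.\<close>
  have "s *\<^sub>R a1 \<in> coderivative F x1 y1 (ys - zs)"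
    using limiting[OF n(1)] m(1)
    by (simp add: coderivative_def scaleR_dual_pair ys_def zs_def scaleR_diff_right)
  moreover have "s *\<^sub>R a2 \<in> coderivative K x2 y2 ys"
    using limiting[OF n(2)] m(2) by (simp add: coderivative_def scaleR_dual_pair ys_def)
  moreover have "s *\<^sub>R a3 \<in> limiting_normal_cone \<Omega> x3"
    using limiting[OF n(3)] m(3) by simp
  moreover have "rest \<in> (\<lambda>b. r *\<^sub>R b) ` cball 0 1"
  proof (rule mem_scaled_unit_cball[OF _ r])
    have "norm rest \<le> s * \<gamma>" using mult_left_mono[OF b(1), of s] s(1) by (simp add: rest_def)
    then show "norm rest \<le> r" using sr \<eta>(4) by simp
  qed
  moreover have "0 = s *\<^sub>R a1 + s *\<^sub>R a2 + s *\<^sub>R a3 + rest" by (simp add: rest_def scaleR_add_right)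
  ultimately have incl: "0 \<in> coderivative F x1 y1 (ys - zs) + coderivative K x2 y2 ys +
      limiting_normal_cone \<Omega> x3 + (\<lambda>b. r *\<^sub>R b) ` cball 0 1"
    by (metis set_plus_intro)

  have "norm zs \<le> s * (2 * \<eta>)" using mult_left_mono[OF b(2), of s] s(1) by (simp add: zs_def)
  also have "\<dots> \<le> 2 * r" using mult_left_mono[OF \<eta>(5), of s] s(1) sr by linarith
  finally have zs: "zs \<in> (\<lambda>b. (2 * r) *\<^sub>R b) ` cball 0 1" by (rule mem_scaled_unit_cball) (use r in simp)

  \<comment> \<open>Since \<open>x2\<close> lies within \<open>\<rho>\<close> of \<open>xb\<close>,
    \<open>p\<close> belongs to the convex cone \<open>K x2\<close>. The vertical ray from
    \<open>(x2, y2)\<close> in direction \<open>(0, p)\<close> therefore stays in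
    \<open>Gr K\<close>.\<close>
  have "blinfun_apply b2 p \<le> 0" if p: "p \<in> P" for p
  proof -
    have "p \<in> K x2" using p m(2) eball[of x2] unfolding P_def by auto
    then have "y2 + t *\<^sub>R p \<in> K x2" if "0 < t" for t
      using add_K[of y2 x2] m(2) cone_K[of x2] that unfolding cone_def Gr_def by auto
    then have "blinfun_apply (dual_pair a2 b2) (0, p) \<le> 0"
      by (intro frechet_normal_cone_ray[OF n(2)]) (auto simp: Gr_def)
    then show ?thesis by (simp add: dual_pair_apply blinfun.zero_right)
  qed
  then have "ys \<in> positive_dual P"
    using s(1) by (auto simp: positive_dual_def ys_def blinfun.minus_left blinfun.scaleR_left
        mult_nonneg_nonpos)
  moreover have "blinfun_apply ys k = 1"
    using s(3) by (simp add: ys_def blinfun.minus_left blinfun.scaleR_left)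
  moreover have "(x1, y1) \<in> Gr F \<inter> (cball xb r \<times> cball yb r)"
    "(x2, y2) \<in> Gr K \<inter> (cball xb r \<times> cball 0 r)" "x3 \<in> \<Omega> \<inter> cball xb r"
    using m \<rho>(2) by auto
  ultimately show ?thesis using zs incl unfolding r_def[symmetric] by blast
qed

end
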